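(* Let $(V,\mathcal{B})$ be a $d$-partite hypergraph with a given $d$-partition $V_1,\ldots,V_d$, let $c\in\mathbb{R}_{\ge0}^V$ be vertex costs, let $n=|V|$, and let $x$ be a fractional vertex cover. There is a deterministic algorithm that computes an integral solution $\bar x\in\{0,1\}^V$ (a vertex cover) of cost $\sum_{v\in V}c_v\bar x_v\le\frac d2\sum_{v\in V}c_vx_v$ in time $\mathcal{O}(n^3)$.
   Context: A hypergraph $(V,\mathcal{B})$ is $d$-partite if there is a partition $V=V_1\dot\cup\cdots\dot\cup V_d$ (a $d$-partition) with $|P\cap V_i|\le1$ for all $P\in\mathcal{B}$ and all $i$; the hypergraph need not be uniform. A fractional vertex cover is a vector $x\in\mathbb{R}_{\ge0}^V$ with $\sum_{v\in P}x_v\ge1$ for all $P\in\mathcal{B}$; an integral solution is $\bar x\in\{0,1\}^V$ with $\sum_{v\in P}\bar x_v\ge1$ for all $P\in\mathcal{B}$. The algorithm receives $V$, the $d$-partition, $c$ and $x$.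
   Formalization: The case d = 1 is excluded, because the claim fails there: for a single vertex v with the hyperedge {v}, cost 1 and x_v = 1, every vertex cover costs 1, which exceeds d/2 = 1/2. *)

theory Defs
  imports Complex_Main "HOL-Library.Disjoint_Sets" "HOL-Library.Landau_Symbols"
begin

definition hypergraph :: "'v set \<Rightarrow> 'v set set \<Rightarrow> bool" where
  "hypergraph V B \<longleftrightarrow> finite V \<and> B \<subseteq> Pow V"

text \<open>Only the values \<open>Vs 1\<close>, ..., \<open>Vs d\<close> are relevant.  Parts may be empty.
  For \<open>d = 1\<close> the factor \<open>d / 2\<close> is unattainable: a single vertex \<open>v\<close> with the hyperedge \<open>{v}\<close>,
  cost 1 and \<open>x v = 1\<close> has no cover of cost at most 1/2.\<close>

definition d_partition :: "'v set \<Rightarrow> 'v set set \<Rightarrow> nat \<Rightarrow> (nat \<Rightarrow> 'v set) \<Rightarrow> bool" where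
  "d_partition V B d Vs \<longleftrightarrow>
     V = (\<Union>i\<in>{1..d}. Vs i) \<and> disjoint_family_on Vs {1..d} \<and>
     (\<forall>P\<in>B. \<forall>i\<in>{1..d}. card (P \<inter> Vs i) \<le> 1)"

definition fractional_vertex_cover :: "'v set \<Rightarrow> 'v set set \<Rightarrow> ('v \<Rightarrow> real) \<Rightarrow> bool" where
  "fractional_vertex_cover V B x \<longleftrightarrow>
     (\<forall>v\<in>V. 0 \<le> x v) \<and> (\<forall>P\<in>B. (\<Sum>v\<in>P. x v) \<ge> 1)"

definition integral_vertex_cover :: "'v set \<Rightarrow> 'v set set \<Rightarrow> ('v \<Rightarrow> real) \<Rightarrow> bool" where
  "integral_vertex_cover V B y \<longleftrightarrow>
     (\<forall>v\<in>V. y v \<in> {0, 1}) \<and> (\<forall>P\<in>B. (\<Sum>v\<in>P. y v) \<ge> 1)"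

text \<open>
  The machine model is a real RAM, presented as a while language.  Its memory consists of named
  arrays of natural numbers (used as indices and counters) and of named arrays of real numbers;
  a scalar variable is cell 0 of an array.  There are no real constants other than those obtained
  from natural numbers, no rounding from reals to naturals, and no multiplication of indices.
  Subtraction of naturals is truncated, and division by zero yields zero, as usual in HOL.
\<close>

type_synonym vname = string

record state =
  nmem :: "vname \<Rightarrow> nat \<Rightarrow> nat"
  rmem :: "vname \<Rightarrow> nat \<Rightarrow> real"

datatype nexp =
    NConst nat
  | NLoad vname nexp
  | NAdd nexp nexp
  | NSub nexp nexp

datatype rexp =
    ROfNat nexp
  | RLoad vname nexp
  | RAdd rexp rexp
  | RSub rexp rexp
  | RMul rexp rexp
  | RDiv rexp rexp

datatype bexp =
    NLess nexp nexp
  | RLess rexp rexp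
  | BNot bexp
  | BAnd bexp bexp

datatype com =
    Skip
  | NStore vname nexp nexp
  | RStore vname nexp rexp
  | Seq com com
  | Cond bexp com com
  | While bexp com

primrec nval :: "nexp \<Rightarrow> state \<Rightarrow> nat" where
  "nval (NConst k) s = k"
| "nval (NLoad a e) s = nmem s a (nval e s)"
| "nval (NAdd e1 e2) s = nval e1 s + nval e2 s"
| "nval (NSub e1 e2) s = nval e1 s - nval e2 s"

primrec rval :: "rexp \<Rightarrow> state \<Rightarrow> real" where
  "rval (ROfNat e) s = real (nval e s)"
| "rval (RLoad a e) s = rmem s a (nval e s)"
| "rval (RAdd e1 e2) s = rval e1 s + rval e2 s"
| "rval (RSub e1 e2) s = rval e1 s - rval e2 s"
| "rval (RMul e1 e2) s = rval e1 s * rval e2 s"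
| "rval (RDiv e1 e2) s = rval e1 s / rval e2 s"

primrec bval :: "bexp \<Rightarrow> state \<Rightarrow> bool" where
  "bval (NLess e1 e2) s \<longleftrightarrow> nval e1 s < nval e2 s"
| "bval (RLess e1 e2) s \<longleftrightarrow> rval e1 s < rval e2 s"
| "bval (BNot b) s \<longleftrightarrow> \<not> bval b s"
| "bval (BAnd b1 b2) s \<longleftrightarrow> bval b1 s \<and> bval b2 s"

definition nstore :: "vname \<Rightarrow> nat \<Rightarrow> nat \<Rightarrow> state \<Rightarrow> state" where
  "nstore a i k s = s\<lparr>nmem := (nmem s)(a := (nmem s a)(i := k))\<rparr>"

definition rstore :: "vname \<Rightarrow> nat \<Rightarrow> real \<Rightarrow> state \<Rightarrow> state" where
  "rstore a i r s = s\<lparr>rmem := (rmem s)(a := (rmem s a)(i := r))\<rparr>"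

text \<open>
  \<open>exec p s t s'\<close>: started in \<open>s\<close>, the program \<open>p\<close> halts in \<open>s'\<close> after \<open>t\<close> time units.  Every
  store and every test is charged one unit.  The expressions are part of the program text, so
  charging each of their operations instead changes the time by at most a factor that depends on
  the program only.
\<close>

inductive exec :: "com \<Rightarrow> state \<Rightarrow> nat \<Rightarrow> state \<Rightarrow> bool" where
  Skip: "exec Skip s 1 s"
| NStore: "exec (NStore a i e) s 1 (nstore a (nval i s) (nval e s) s)"
| RStore: "exec (RStore a i e) s 1 (rstore a (nval i s) (rval e s) s)"
| Seq: "exec p s t s' \<Longrightarrow> exec q s' u s'' \<Longrightarrow> exec (Seq p q) s (t + u) s''"
| CondTrue: "bval b s \<Longrightarrow> exec p s t s' \<Longrightarrow> exec (Cond b p q) s (1 + t) s'"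
| CondFalse: "\<not> bval b s \<Longrightarrow> exec q s t s' \<Longrightarrow> exec (Cond b p q) s (1 + t) s'"
| WhileFalse: "\<not> bval b s \<Longrightarrow> exec (While b p) s 1 s"
| WhileTrue: "bval b s \<Longrightarrow> exec p s t s' \<Longrightarrow> exec (While b p) s' u s'' \<Longrightarrow>
    exec (While b p) s (1 + t + u) s''"

inductive_cases exec_SkipE: "exec Skip s t s'"
inductive_cases exec_NStoreE: "exec (NStore a i e) s t s'"
inductive_cases exec_RStoreE: "exec (RStore a i e) s t s'"
inductive_cases exec_SeqE: "exec (Seq p q) s t s'"
inductive_cases exec_CondE: "exec (Cond b p q) s t s'"
inductive_cases exec_WhileE: "exec (While b p) s t s'"

lemma exec_deterministic:
  assumes "exec p s t s'" and "exec p s u s''"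
  shows "t = u \<and> s' = s''"
  using assms
proof (induction arbitrary: u s'' rule: exec.induct)
  case (Skip s)
  then show ?case by (auto elim: exec_SkipE)
next
  case (NStore a i e s)
  then show ?case by (auto elim: exec_NStoreE)
next
  case (RStore a i e s)
  then show ?case by (auto elim: exec_RStoreE)
next
  case (Seq p s t s' q t' r)
  from Seq.prems obtain v r' w where "exec p s v r'" "exec q r' w s''" "u = v + w"
    by (rule exec_SeqE)
  with Seq.IH show ?case by metis
next
  case (CondTrue b s p t s' q)
  from CondTrue.prems obtain v where "exec p s v s''" "u = 1 + v"
    using CondTrue.hyps by (auto elim: exec_CondE)
  with CondTrue.IH show ?case by metis
next
  case (CondFalse b s q t s' p)
  from CondFalse.prems obtain v where "exec q s v s''" "u = 1 + v"
    using CondFalse.hyps by (auto elim: exec_CondE)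
  with CondFalse.IH show ?case by metis
next
  case (WhileFalse b s p)
  from WhileFalse.prems show ?case using WhileFalse.hyps by (cases rule: exec_WhileE) auto
next
  case (WhileTrue b s p t s' t' r)
  from WhileTrue.prems obtain v r' w
    where "exec p s v r'" "exec (While b p) r' w s''" "u = 1 + v + w"
    using WhileTrue.hyps by (cases rule: exec_WhileE) auto
  with WhileTrue.IH show ?case by metis
qed

text \<open>
  An instance with vertex set \<open>{..<n}\<close> is presented to the machine as the numbers \<open>n\<close> and \<open>d\<close>,
  the array \<open>p\<close> that maps each vertex to the index of its part, and the arrays \<open>c\<close> and \<open>x\<close>.  All
  remaining memory is zero.  In particular the set of hyperedges is not part of the input.  The
  result is read off the real array \<open>y\<close>.
\<close>

definition part_index :: "nat \<Rightarrow> (nat \<Rightarrow> 'v set) \<Rightarrow> 'v \<Rightarrow> nat" where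
  "part_index d Vs v = (THE i. i \<in> {1..d} \<and> v \<in> Vs i)"

definition input_state ::
  "nat \<Rightarrow> nat \<Rightarrow> (nat \<Rightarrow> nat set) \<Rightarrow> (nat \<Rightarrow> real) \<Rightarrow> (nat \<Rightarrow> real) \<Rightarrow> state" where
  "input_state n d Vs c x =
     \<lparr>nmem = (\<lambda>a i.
        if a = ''n'' \<and> i = 0 then n
        else if a = ''d'' \<and> i = 0 then d
        else if a = ''p'' \<and> i < n then part_index d Vs i
        else 0),
      rmem = (\<lambda>a i.
        if a = ''c'' \<and> i < n then c i
        else if a = ''x'' \<and> i < n then x i
        else 0)\<rparr>"

definition result :: "state \<Rightarrow> nat \<Rightarrow> real" where
  "result s = rmem s ''y''"

end

theory Submission
  imports Defs "HOL-Analysis.Analysis"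
begin

text \<open>
  Let \<open>K\<close> be the number of parts and \<open>z v = x v * K / 2\<close>.  Give part \<open>j\<close> a threshold \<open>\<tau> j\<close>, and select
  \<open>v\<close> if \<open>z v\<close> reaches the threshold of its part.  If the thresholds are nonnegative with sum \<open>K / 2\<close>,
  then every hyperedge contains a selected vertex, whatever the hyperedges are.  If moreover each
  \<open>\<tau> j\<close> is uniformly distributed on \<open>[0, 1]\<close>, then \<open>v\<close> is selected with probability at most \<open>z v\<close>, and
  the expected cost is at most \<open>K / 2\<close> times that of \<open>x\<close>.  Such thresholds can be made to depend on a
  single uniform \<open>u\<close>, and the selection changes only at \<open>O(n)\<close> breakpoints of \<open>u\<close>.  So the midpoint of
  some pair of breakpoints is as good as the average, and testing all \<open>O(n\<^sup>2)\<close> pairs in time \<open>O(n)\<close>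
  each finds it.
\<close>

section \<open>Thresholds with uniform marginals and constant sum\<close>

text \<open>Pairs of parts get \<open>u\<close> and \<open>1 - u\<close>.  For odd \<open>K\<close> three parts remain; they get \<open>u\<close>,
  \<open>(u + 1/2) mod 1\<close> and the difference of these two to \<open>3/2\<close>, which is again uniform.\<close>

definition threshold :: "nat \<Rightarrow> nat \<Rightarrow> real \<Rightarrow> real" where
  "threshold K j u =
     (if odd K \<and> j = K then (if u < 1/2 then 1 - 2 * u else 2 - 2 * u)
      else if odd K \<and> Suc j = K then (if u < 1/2 then u + 1/2 else u - 1/2)
      else if 2 * j \<le> K then u else 1 - u)"

lemma threshold_nonneg: "0 \<le> u \<Longrightarrow> u \<le> 1 \<Longrightarrow> 0 \<le> threshold K j u"
  by (auto simp: threshold_def)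

lemma sum_threshold:
  assumes "2 \<le> K"
  shows "(\<Sum>j=1..K. threshold K j u) = real K / 2"
proof (cases "even K")
  case True
  then obtain m where K: "K = 2 * m" by blast
  have "{1..K} = {1..m} \<union> {m+1..2*m}" using K by auto
  then have "(\<Sum>j=1..K. threshold K j u)
      = (\<Sum>j=1..m. threshold K j u) + (\<Sum>j=m+1..2*m. threshold K j u)"
    by (simp add: sum.union_disjoint)
  also have "(\<Sum>j=1..m. threshold K j u) = (\<Sum>j=1..m. u)"
    by (rule sum.cong) (auto simp: threshold_def K)
  also have "(\<Sum>j=m+1..2*m. threshold K j u) = (\<Sum>j=m+1..2*m. 1 - u)"
    by (rule sum.cong) (auto simp: threshold_def K)
  finally show ?thesis by (simp add: K algebra_simps)
next
  case False
  then obtain m' where "K = 2 * m' + 1" by (rule oddE)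
  with assms obtain m where K: "K = 2 * m + 3" by (cases m') auto
  \<comment> \<open>With \<open>K = 2 * m + 3\<close> the first block has one index more than the
    second. Its spare \<open>u\<close> joins the thresholds of the last two indices, and these three
    add up to \<open>3/2\<close> on either side of \<open>u = 1/2\<close>.\<close>
  have "{1..K} = {1..m+1} \<union> {m+2..2*m+1} \<union> {2*m+2, 2*m+3}" using K by auto
  then have "(\<Sum>j=1..K. threshold K j u)
      = (\<Sum>j=1..m+1. threshold K j u) + (\<Sum>j=m+2..2*m+1. threshold K j u)
        + (threshold K (2*m+2) u + threshold K (2*m+3) u)"
    by (simp add: sum.union_disjoint)
  also have "(\<Sum>j=1..m+1. threshold K j u) = (\<Sum>j=1..m+1. u)"
    by (rule sum.cong) (auto simp: threshold_def K)
  also have "(\<Sum>j=m+2..2*m+1. threshold K j u) = (\<Sum>j=m+2..2*m+1. 1 - u)"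
    by (rule sum.cong) (auto simp: threshold_def K)
  finally show ?thesis by (simp add: threshold_def K algebra_simps)
qed

text \<open>If every vertex of \<open>P\<close> missed its threshold, the scaled values, whose sum
  is at least \<open>K / 2\<close>, would add up to less than the thresholds of the ranks met by
  \<open>P\<close>. These ranks are distinct, so their thresholds sum to at most
  \<open>K / 2\<close>.\<close>

lemma threshold_covers:
  fixes x :: "'v \<Rightarrow> real"
  assumes "2 \<le> K" "finite P" "inj_on rk P" "rk ` P \<subseteq> {1..K}" "1 \<le> (\<Sum>v\<in>P. x v)"
    and u: "0 \<le> u" "u \<le> 1"
  shows "\<exists>v\<in>P. threshold K (rk v) u \<le> x v * real K / 2"
proof (rule ccontr)
  assume "\<not> ?thesis"
  then have "\<forall>v\<in>P. x v * real K / 2 < threshold K (rk v) u" by auto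
  moreover have "P \<noteq> {}" using assms(5) by auto
  ultimately have "(\<Sum>v\<in>P. x v * real K / 2) < (\<Sum>v\<in>P. threshold K (rk v) u)"
    using assms(2) by (intro sum_strict_mono) auto
  also have "\<dots> = (\<Sum>j\<in>rk ` P. threshold K j u)"
    using assms(3) by (simp add: sum.reindex)
  \<comment> \<open>Ranks that \<open>P\<close> does not meet are added here. This needs nonnegative
    thresholds, hence \<open>u\<close> in the unit interval.\<close>
  also have "\<dots> \<le> (\<Sum>j=1..K. threshold K j u)"
    using assms(4) u by (intro sum_mono2) (auto simp: threshold_nonneg)
  also have "\<dots> = real K / 2" by (rule sum_threshold) fact
  finally have "(\<Sum>v\<in>P. x v) * (real K / 2) < 1 * (real K / 2)"
    unfolding sum_distrib_right by simp
  then have "(\<Sum>v\<in>P. x v) < 1"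
    using assms(1) by (subst (asm) mult_less_cancel_right_pos) auto
  with assms(5) show False by simp
qed

section \<open>Probability of selection and averaging over \<open>u\<close>\<close>

definition accept :: "nat \<Rightarrow> nat \<Rightarrow> real \<Rightarrow> real set" where
  "accept K j z = {u \<in> {0..1}. threshold K j u \<le> z}"

lemma accept_measurable [measurable]: "accept K j z \<in> sets borel"
proof -
  have "accept K j z = {0..1} \<inter> {u \<in> space borel. threshold K j u \<le> z}"
    by (auto simp: accept_def)
  also have "\<dots> \<in> sets borel" unfolding threshold_def by measurable
  finally show ?thesis .
qed

text \<open>The threshold is piecewise linear in \<open>u\<close> with at most two pieces, so the
  accepting \<open>u\<close> lie in two intervals whose lengths can be read off. The averaging
  argument needs only the upper bound.\<close>

lemma measure_accept_le:
  assumes "0 \<le> z"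
  shows "measure lborel (accept K j z) \<le> z"
proof -
  have two: ?thesis
    if "accept K j z \<subseteq> {a..b} \<union> {a'..b'}" "a \<le> b" "a' \<le> b'" "(b - a) + (b' - a') \<le> z"
    for a b a' b' :: real
  proof -
    have "{r..t} \<in> fmeasurable lborel" for r t :: real
      by (cases "r \<le> t") (auto simp: fmeasurable_def)
    then have "measure lborel (accept K j z) \<le> measure lborel ({a..b} \<union> {a'..b'})"
      using that(1) by (intro measure_mono_fmeasurable) auto
    also have "\<dots> \<le> measure lborel {a..b} + measure lborel {a'..b'}"
      by (intro measure_Un_le) auto
    also have "\<dots> \<le> z" using that by simp
    finally show ?thesis .
  qed
  show ?thesis
  proof (cases "1 \<le> z")
    case True
    then show ?thesis by (intro two[of 0 1 0 0]) (auto simp: accept_def)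
  next
    case False
    consider "odd K" "j = K" | "odd K" "Suc j = K" | "\<not> (odd K \<and> (j = K \<or> Suc j = K))" "2 * j \<le> K"
      | "\<not> (odd K \<and> (j = K \<or> Suc j = K))" "\<not> 2 * j \<le> K" by blast
    then show ?thesis
    proof cases
      case 1
      \<comment> \<open>The threshold falls with slope -2 on each half of the unit interval, so each
        half contributes \<open>z / 2\<close>.\<close>
      have "(1/2 - (1 - z) / 2) + (1 - (1 - z / 2)) \<le> z"
        by (simp add: field_simps)
      with 1 show ?thesis using assms False
        by (intro two[of "(1 - z) / 2" "1/2" "1 - z / 2" 1])
          (auto simp: accept_def threshold_def split: if_splits)
    next
      case 2
      show ?thesis
      \<comment> \<open>The accepting set starts at \<open>1/2\<close> and has length
        \<open>z\<close>; from \<open>z = 1/2\<close> on it wraps around and continues at 0.\<close>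
      proof (cases "z < 1/2")
        case True
        with 2 show ?thesis using assms
          by (intro two[of "1/2" "z + 1/2" 0 0])
            (auto simp: accept_def threshold_def split: if_splits)
      next
        case False
        with 2 \<open>\<not> 1 \<le> z\<close> show ?thesis
          by (intro two[of 0 "z - 1/2" "1/2" 1])
            (auto simp: accept_def threshold_def split: if_splits)
      qed
    next
      case 3
      then have "\<not> (odd K \<and> j = K)" "\<not> (odd K \<and> Suc j = K)" by blast+
      with 3 have "threshold K j u = u" for u by (simp only: threshold_def if_True if_False)
      then show ?thesis using assms
        by (intro two[of 0 z 0 0]) (auto simp: accept_def)
    next
      case 4
      then have "\<not> (odd K \<and> j = K)" "\<not> (odd K \<and> Suc j = K)" by blast+
      with 4 have "threshold K j u = 1 - u" for u by (simp only: threshold_def if_True if_False)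
      then show ?thesis using assms
        by (intro two[of "1 - z" 1 1 1]) (auto simp: accept_def)
    qed
  qed
qed

text \<open>First-moment argument: if all \<open>u\<close> outside \<open>F\<close> exceeded the
  bound, so would the integral over the unit interval. A finite \<open>F\<close> is a null set,
  which is why \<open>u\<close> can be kept away from it.\<close>

lemma average_point:
  fixes c m :: "'v \<Rightarrow> real" and S :: "'v \<Rightarrow> real set"
  assumes "finite V" "finite F" "\<And>v. v \<in> V \<Longrightarrow> S v \<in> sets borel" "\<And>v. S v \<subseteq> {0..1}"
    and "\<And>v. v \<in> V \<Longrightarrow> measure lborel (S v) \<le> m v" "\<And>v. v \<in> V \<Longrightarrow> 0 \<le> c v"
  shows "\<exists>u\<in>{0..1} - F. (\<Sum>v\<in>V. c v * indicat_real (S v) u) \<le> (\<Sum>v\<in>V. c v * m v)"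
proof (rule ccontr)
  assume neg: "\<not> ?thesis"
  define M :: "real measure" where "M = restrict_space lborel {0..1}"
  have em: "emeasure M (space M) = 1"
    by (simp add: M_def emeasure_restrict_space space_restrict_space)
  then interpret finite_measure M by (intro finite_measureI) simp
  have F: "AE u in M. u \<notin> F"
  proof -
    have "AE u in lborel. u \<notin> F"
      using assms(2) by (intro AE_not_in finite_imp_null_set_lborel)
    then show ?thesis by (subst M_def, subst AE_restrict_space_iff) (auto elim: eventually_mono)
  qed
  have S: "S v \<in> sets M" if "v \<in> V" for v
    using that assms(3,4) by (auto simp: M_def sets_restrict_space_iff)
  have int: "integrable M (\<lambda>u. c v * indicat_real (S v) u)" if "v \<in> V" for v
    using S[OF that] by (intro integrable_mult_right integrable_real_indicator)
      (auto simp: emeasure_eq_measure)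
  have mS: "measure M (S v) = measure lborel (S v)" if "v \<in> V" for v
    unfolding M_def using assms(4) by (intro measure_restrict_space) auto
  have "(\<integral>u. (\<Sum>v\<in>V. c v * m v) \<partial>M) < (\<integral>u. (\<Sum>v\<in>V. c v * indicat_real (S v) u) \<partial>M)"
  proof (rule integral_less_AE_space)
    show "AE u in M. (\<Sum>v\<in>V. c v * m v) < (\<Sum>v\<in>V. c v * indicat_real (S v) u)"
      using F AE_space
    proof eventually_elim
      case (elim u)
      then have "u \<in> {0..1} - F" by (simp add: M_def space_restrict_space)
      with neg show ?case by (meson not_le)
    qed
  qed (use em int in auto)
  also have "\<dots> = (\<Sum>v\<in>V. c v * measure lborel (S v))"
    using int S mS by (subst Bochner_Integration.integral_sum) auto
  also have "\<dots> \<le> (\<Sum>v\<in>V. c v * m v)"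
    using assms(5,6) by (intro sum_mono mult_left_mono)
  finally show False using em by (simp add: measure_def)
qed

section \<open>Reduction to midpoints of breakpoints\<close>

lemma neighbours_in_finite_set:
  fixes u :: "'a :: linorder"
  assumes "finite F" "u \<notin> F" "lo \<in> F" "lo \<le> u" "hi \<in> F" "u \<le> hi"
  obtains a b where "a \<in> F" "b \<in> F" "a < u" "u < b" "\<And>f. f \<in> F \<Longrightarrow> f \<le> a \<or> b \<le> f"
proof -
  let ?A = "{f \<in> F. f < u}" and ?B = "{f \<in> F. u < f}"
  have A: "Max ?A \<in> ?A" using assms by (intro Max_in) (auto simp: order.order_iff_strict)
  have B: "Min ?B \<in> ?B" using assms by (intro Min_in) (auto simp: order.order_iff_strict)
  have "f \<le> Max ?A \<or> Min ?B \<le> f" if "f \<in> F" for f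
  proof (cases "f < u")
    case True
    then show ?thesis using that assms(1) by (intro disjI1 Max_ge) auto
  next
    case False
    then have "u < f" using that assms(2) by (metis linorder_neqE)
    then show ?thesis using that assms(1) by (intro disjI2 Min_le) auto
  qed
  with A B show thesis by (intro that[of "Max ?A" "Min ?B"]) auto
qed

text \<open>The solutions \<open>u\<close> of \<open>threshold K j u = z\<close> for the six linear
  formulas that occur in \<open>threshold\<close>. Listing all of them for every vertex makes the
  set independent of \<open>K\<close> and of the rank.\<close>

definition breakpoints :: "real \<Rightarrow> real set" where
  "breakpoints z = {z, 1 - z, z - 1/2, z + 1/2, (1 - z) / 2, 1 - z / 2}"

text \<open>Membership in \<open>accept\<close> is a Boolean combination of comparisons of
  \<open>u\<close> with breakpoints and with 0, 1/2, 1. None of these points lies strictly between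
  \<open>a\<close> and \<open>b\<close>, so no comparison changes there.\<close>

lemma accept_between_breakpoints:
  assumes "\<And>f. f \<in> breakpoints z \<union> {0, 1/2, 1} \<Longrightarrow> f \<le> a \<or> b \<le> f"
    and "a < u" "u < b" "a < u'" "u' < b"
  shows "u \<in> accept K j z \<longleftrightarrow> u' \<in> accept K j z"
proof -
  have eq: "u \<le> f \<longleftrightarrow> u' \<le> f" "f \<le> u \<longleftrightarrow> f \<le> u'" "u < f \<longleftrightarrow> u' < f"
    if "f \<in> breakpoints z \<union> {0, 1/2, 1}" for f
    using assms(1)[OF that] assms(2-) by auto
  have 1: "0 \<le> u \<longleftrightarrow> 0 \<le> u'" "u \<le> 1 \<longleftrightarrow> u' \<le> 1" "u < 1/2 \<longleftrightarrow> u' < 1/2"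
    by (intro eq; simp)+
  have 2: "u \<le> z \<longleftrightarrow> u' \<le> z" "1 - z \<le> u \<longleftrightarrow> 1 - z \<le> u'"
    "u \<le> z - 1/2 \<longleftrightarrow> u' \<le> z - 1/2" "u \<le> z + 1/2 \<longleftrightarrow> u' \<le> z + 1/2"
    "(1 - z) / 2 \<le> u \<longleftrightarrow> (1 - z) / 2 \<le> u'" "1 - z / 2 \<le> u \<longleftrightarrow> 1 - z / 2 \<le> u'"
    by (intro eq; simp add: breakpoints_def)+
  have 3: "1 - w \<le> z \<longleftrightarrow> 1 - z \<le> w" "w + 1/2 \<le> z \<longleftrightarrow> w \<le> z - 1/2" "w - 1/2 \<le> z \<longleftrightarrow> w \<le> z + 1/2"
    "1 - 2 * w \<le> z \<longleftrightarrow> (1 - z) / 2 \<le> w" "2 - 2 * w \<le> z \<longleftrightarrow> 1 - z / 2 \<le> w" for w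
    by (auto simp: field_simps)
  show ?thesis unfolding accept_def threshold_def mem_Collect_eq atLeastAtMost_iff
    using 1 2 3 by presburger
qed

definition choose_at :: "nat \<Rightarrow> (nat \<Rightarrow> nat) \<Rightarrow> (nat \<Rightarrow> real) \<Rightarrow> real \<Rightarrow> nat \<Rightarrow> real" where
  "choose_at K rk z u v = (if threshold K (rk v) u \<le> z v then 1 else 0)"

text \<open>The witnesses are the neighbours in \<open>F\<close> of an average point; their midpoint
  selects the same vertices as that point. The statement does not ask for neighbours, so the program
  can try all pairs without sorting.\<close>

lemma good_midpoint:
  fixes c z :: "nat \<Rightarrow> real"
  assumes c: "\<And>v. v < n \<Longrightarrow> 0 \<le> c v" and z: "\<And>v. v < n \<Longrightarrow> 0 \<le> z v"
    and fin: "finite F" and F: "{0, 1/2, 1} \<union> (\<Union>v<n. breakpoints (z v)) \<subseteq> F"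
  shows "\<exists>a\<in>F. \<exists>b\<in>F. 0 \<le> (a + b) / 2 \<and> (a + b) / 2 \<le> 1 \<and>
    (\<Sum>v<n. c v * choose_at K rk z ((a + b) / 2) v) \<le> (\<Sum>v<n. c v * z v)"
proof -
  obtain u where u: "u \<in> {0..1} - F"
    and le: "(\<Sum>v<n. c v * indicat_real (accept K (rk v) (z v)) u) \<le> (\<Sum>v<n. c v * z v)"
  proof -
    have "\<exists>u\<in>{0..1} - F. (\<Sum>v<n. c v * indicat_real (accept K (rk v) (z v)) u) \<le> (\<Sum>v<n. c v * z v)"
      using fin c z by (intro average_point) (auto simp: measure_accept_le, auto simp: accept_def)
    then show thesis using that by blast
  qed
  obtain a b where ab: "a \<in> F" "b \<in> F" "a < u" "u < b" "\<And>f. f \<in> F \<Longrightarrow> f \<le> a \<or> b \<le> f"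
    using neighbours_in_finite_set[of F u 0 1] fin u F by auto
  let ?m = "(a + b) / 2"
  have m: "a < ?m" "?m < b" using ab by auto
  \<comment> \<open>\<open>accept\<close> confines \<open>u\<close> to the unit interval while
    \<open>choose_at\<close> does not, so the range of the midpoint has to be shown
    separately.\<close>
  have "0 \<le> a" "b \<le> 1" using ab(5)[of 0] ab(5)[of 1] F u ab(3,4) by auto
  then have m01: "0 \<le> ?m" "?m \<le> 1" using m by auto
  have "choose_at K rk z ?m v = indicat_real (accept K (rk v) (z v)) u" if "v < n" for v
  proof -
    have "u \<in> accept K (rk v) (z v) \<longleftrightarrow> ?m \<in> accept K (rk v) (z v)"
    proof (rule accept_between_breakpoints[of _ a b])
      fix f assume "f \<in> breakpoints (z v) \<union> {0, 1/2, 1}"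
      with F that have "f \<in> F" by blast
      then show "f \<le> a \<or> b \<le> f" by (rule ab(5))
    qed (use ab m in auto)
    then show ?thesis using m01 by (auto simp: choose_at_def accept_def indicator_def)
  qed
  then have "(\<Sum>v<n. c v * choose_at K rk z ?m v) \<le> (\<Sum>v<n. c v * z v)" using le by simp
  with ab m01 show ?thesis by blast
qed

section \<open>Weakest preconditions with running time\<close>

text \<open>Execution is deterministic, so the existential yields the weakest precondition for total
  correctness, with the time as an argument of the postcondition.\<close>

definition runs :: "com \<Rightarrow> state \<Rightarrow> (nat \<Rightarrow> state \<Rightarrow> bool) \<Rightarrow> bool" where
  "runs p s Q \<longleftrightarrow> (\<exists>t s'. exec p s t s' \<and> Q t s')"

lemma runs_mono: "runs p s Q \<Longrightarrow> (\<And>t s'. Q t s' \<Longrightarrow> Q' t s') \<Longrightarrow> runs p s Q'"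
  by (auto simp: runs_def)

lemma runs_Skip [simp]: "runs Skip s Q \<longleftrightarrow> Q 1 s"
  unfolding runs_def by (metis exec.Skip exec_SkipE)

lemma runs_NStore [simp]: "runs (NStore a i e) s Q \<longleftrightarrow> Q 1 (nstore a (nval i s) (nval e s) s)"
  unfolding runs_def by (metis exec.NStore exec_NStoreE)

lemma runs_RStore [simp]: "runs (RStore a i e) s Q \<longleftrightarrow> Q 1 (rstore a (nval i s) (rval e s) s)"
  unfolding runs_def by (metis exec.RStore exec_RStoreE)

lemma runs_Seq [simp]: "runs (Seq p q) s Q \<longleftrightarrow> runs p s (\<lambda>t s'. runs q s' (\<lambda>u. Q (t + u)))"
  unfolding runs_def by (fastforce intro: exec.Seq elim: exec_SeqE)

lemma runs_Cond [simp]: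
  "runs (Cond b p q) s Q \<longleftrightarrow>
     (if bval b s then runs p s (\<lambda>t. Q (1 + t)) else runs q s (\<lambda>t. Q (1 + t)))"
  unfolding runs_def by (auto elim!: exec_CondE) (metis exec.CondTrue exec.CondFalse plus_1_eq_Suc)+

text \<open>Unlike the preceding equations this one would rewrite forever, so it is applied by
  hand.\<close>

lemma runs_While:
  "runs (While b p) s Q \<longleftrightarrow>
     (if bval b s then runs p s (\<lambda>t s'. runs (While b p) s' (\<lambda>u. Q (1 + t + u))) else Q 1 s)"
proof (cases "bval b s")
  case True
  show ?thesis
  proof
    assume "runs (While b p) s Q"
    with True show "if bval b s then runs p s (\<lambda>t s'. runs (While b p) s' (\<lambda>u. Q (1 + t + u))) else Q 1 s"
      unfolding runs_def by (fastforce elim: exec_WhileE)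
  next
    assume "if bval b s then runs p s (\<lambda>t s'. runs (While b p) s' (\<lambda>u. Q (1 + t + u))) else Q 1 s"
    with True show "runs (While b p) s Q"
      unfolding runs_def using exec.WhileTrue by metis
  qed
next
  case False
  then show ?thesis unfolding runs_def by (metis exec.WhileFalse exec_WhileE One_nat_def)
qed

abbreviation NVar :: "vname \<Rightarrow> nexp" where "NVar a \<equiv> NLoad a (NConst 0)"
abbreviation RVar :: "vname \<Rightarrow> rexp" where "RVar a \<equiv> RLoad a (NConst 0)"
abbreviation RConst :: "nat \<Rightarrow> rexp" where "RConst k \<equiv> ROfNat (NConst k)"
abbreviation Half :: rexp where "Half \<equiv> RDiv (RConst 1) (RConst 2)"
abbreviation NSet :: "vname \<Rightarrow> nexp \<Rightarrow> com" where "NSet a e \<equiv> NStore a (NConst 0) e"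
abbreviation RSet :: "vname \<Rightarrow> rexp \<Rightarrow> com" where "RSet a e \<equiv> RStore a (NConst 0) e"

definition For :: "vname \<Rightarrow> nexp \<Rightarrow> com \<Rightarrow> com" where
  "For i e p = Seq (NSet i (NConst 0))
     (While (NLess (NVar i) e) (Seq p (NSet i (NAdd (NVar i) (NConst 1)))))"

text \<open>The invariant is indexed by the counter and is asserted after the increment. The bound
  \<open>e\<close> is evaluated again at every test, so the invariant must fix its value. A round
  costs its test, at most \<open>T\<close>, and the increment; the initial store and the failing
  test account for the other 2.\<close>

lemma runs_For:
  assumes init: "I 0 (nstore i 0 0 s)"
    and ctr: "\<And>k s. I k s \<Longrightarrow> nmem s i 0 = k \<and> nval e s = N"
    and step: "\<And>k s. k < N \<Longrightarrow> I k s \<Longrightarrow>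
      runs p s (\<lambda>t s'. t \<le> T \<and> nmem s' i 0 = k \<and> I (Suc k) (nstore i 0 (Suc k) s'))"
    and fin: "\<And>t s'. t \<le> 2 + N * (T + 2) \<Longrightarrow> I N s' \<Longrightarrow> Q t s'"
  shows "runs (For i e p) s Q"
proof -
  let ?w = "While (NLess (NVar i) e) (Seq p (NSet i (NAdd (NVar i) (NConst 1))))"
  have loop: "runs ?w s (\<lambda>t s'. t \<le> 1 + m * (T + 2) \<and> I N s')"
    if "I k s" "k + m = N" for k m s
    using that
  proof (induction m arbitrary: k s)
    case 0
    then show ?case using ctr[of k s] by (subst runs_While) simp
  next
    case (Suc m)
    have lt: "bval (NLess (NVar i) e) s"
      using ctr[OF Suc.prems(1)] Suc.prems by simp
    have "runs p s (\<lambda>t s'. t \<le> T \<and> nmem s' i 0 = k \<and> I (Suc k) (nstore i 0 (Suc k) s'))"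
      using Suc.prems by (intro step) auto
    then have "runs p s (\<lambda>t s'. runs ?w (nstore i 0 (nmem s' i 0 + 1) s')
        (\<lambda>u s''. 1 + (t + 1) + u \<le> 1 + Suc m * (T + 2) \<and> I N s''))"
    proof (rule runs_mono, elim conjE)
      fix t s' assume t: "t \<le> T" and k: "nmem s' i 0 = k" and "I (Suc k) (nstore i 0 (Suc k) s')"
      then have "runs ?w (nstore i 0 (Suc k) s') (\<lambda>t s'. t \<le> 1 + m * (T + 2) \<and> I N s')"
        using Suc.prems by (intro Suc.IH) auto
      then have "runs ?w (nstore i 0 (Suc k) s')
        (\<lambda>u s''. 1 + (t + 1) + u \<le> 1 + Suc m * (T + 2) \<and> I N s'')"
        by (rule runs_mono) (use t in auto)
      then show "runs ?w (nstore i 0 (nmem s' i 0 + 1) s')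
        (\<lambda>u s''. 1 + (t + 1) + u \<le> 1 + Suc m * (T + 2) \<and> I N s'')"
        by (simp only: k Suc_eq_plus1)
    qed
    then show ?case
      by (subst runs_While) (simp only: lt if_True runs_Seq runs_NStore nval.simps)
  qed
  have "runs ?w (nstore i 0 0 s) (\<lambda>t s'. t \<le> 1 + N * (T + 2) \<and> I N s')"
    by (rule loop[OF init]) simp
  then show ?thesis unfolding For_def by (auto elim!: runs_mono intro: fin)
qed

lemma nmem_nstore [simp]:
    "nmem (nstore a i k s) b = (if b = a then (nmem s a)(i := k) else nmem s b)"
  and rmem_nstore [simp]: "rmem (nstore a i k s) = rmem s"
  and nmem_rstore [simp]: "nmem (rstore a i r s) = nmem s"
  and rmem_rstore [simp]:
    "rmem (rstore a i r s) b = (if b = a then (rmem s a)(i := r) else rmem s b)"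
  by (auto simp: nstore_def rstore_def)

section \<open>The program\<close>

text \<open>Numbers the nonempty parts in order of first appearance: \<open>r\<close> maps a part index to its rank,
  \<open>k\<close> counts the ranks, and \<open>h\<close> is the parity of \<open>k\<close>.  A second, empty part is added if there is
  just one; this is where \<open>d \<noteq> 1\<close> is needed.\<close>

definition rank_vertex :: com where
  "rank_vertex =
     Cond (NLess (NLoad ''r'' (NLoad ''p'' (NVar ''i''))) (NConst 1))
       (Seq (NSet ''k'' (NAdd (NVar ''k'') (NConst 1)))
         (Seq (NSet ''h'' (NSub (NConst 1) (NVar ''h'')))
           (NStore ''r'' (NLoad ''p'' (NVar ''i'')) (NVar ''k''))))
       Skip"

definition rank_parts :: com where
  "rank_parts =
     Seq (For ''i'' (NVar ''n'') rank_vertex)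
         (Cond (NLess (NVar ''k'') (NConst 2))
           (Seq (NSet ''k'' (NConst 2)) (NSet ''h'' (NConst 0)))
           Skip)"

definition push :: "rexp \<Rightarrow> com" where
  "push e = Seq (RStore ''b'' (NVar ''m'') e) (NSet ''m'' (NAdd (NVar ''m'') (NConst 1)))"

text \<open>\<open>z\<close> is \<open>x\<close> scaled by \<open>k / 2\<close>, \<open>w\<close> is the cost of \<open>z\<close>, and \<open>b\<close> lists the \<open>m\<close> breakpoints.\<close>

definition collect_vertex :: com where
  "collect_vertex =
     Seq (RStore ''z'' (NVar ''i'')
            (RMul (RLoad ''x'' (NVar ''i'')) (RDiv (ROfNat (NVar ''k'')) (RConst 2))))
     (Seq (RSet ''w'' (RAdd (RVar ''w'') (RMul (RLoad ''c'' (NVar ''i'')) (RLoad ''z'' (NVar ''i'')))))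
     (Seq (push (RLoad ''z'' (NVar ''i'')))
     (Seq (push (RSub (RConst 1) (RLoad ''z'' (NVar ''i''))))
     (Seq (push (RSub (RLoad ''z'' (NVar ''i'')) Half))
     (Seq (push (RAdd (RLoad ''z'' (NVar ''i'')) Half))
     (Seq (push (RDiv (RSub (RConst 1) (RLoad ''z'' (NVar ''i''))) (RConst 2)))
          (push (RSub (RConst 1) (RDiv (RLoad ''z'' (NVar ''i'')) (RConst 2))))))))))"

definition collect_breakpoints :: com where
  "collect_breakpoints =
     Seq (push (RConst 0)) (Seq (push Half) (Seq (push (RConst 1))
       (For ''i'' (NVar ''n'') collect_vertex)))"

abbreviation Rank :: nexp where "Rank \<equiv> NLoad ''r'' (NLoad ''p'' (NVar ''l''))"
abbreviation NEq :: "nexp \<Rightarrow> nexp \<Rightarrow> bexp" where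
  "NEq e f \<equiv> BAnd (BNot (NLess e f)) (BNot (NLess f e))"

text \<open>Evaluates \<open>threshold\<close> with the operations at hand: parity is read from
  \<open>h\<close>, equality of indices is the failure of both strict comparisons, and
  \<open>2 * j\<close> becomes a sum. The last test is the negated one, so its branches are
  swapped.\<close>

definition compute_threshold :: com where
  "compute_threshold =
     Cond (BAnd (NEq (NVar ''h'') (NConst 1)) (NEq Rank (NVar ''k'')))
       (Cond (RLess (RVar ''u'') Half)
         (RSet ''t'' (RSub (RConst 1) (RMul (RConst 2) (RVar ''u''))))
         (RSet ''t'' (RSub (RConst 2) (RMul (RConst 2) (RVar ''u'')))))
     (Cond (BAnd (NEq (NVar ''h'') (NConst 1)) (NEq (NAdd Rank (NConst 1)) (NVar ''k'')))
       (Cond (RLess (RVar ''u'') Half)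
         (RSet ''t'' (RAdd (RVar ''u'') Half))
         (RSet ''t'' (RSub (RVar ''u'') Half)))
     (Cond (NLess (NVar ''k'') (NAdd Rank Rank))
       (RSet ''t'' (RSub (RConst 1) (RVar ''u'')))
       (RSet ''t'' (RVar ''u''))))"

text \<open>\<open>g\<close> is the cost of the cover \<open>y\<close> selected at \<open>u\<close>; the last \<open>u\<close> that met the bound is kept in \<open>v\<close>.\<close>

definition choose_vertex :: com where
  "choose_vertex =
     Cond (RLess (RLoad ''z'' (NVar ''l'')) (RVar ''t''))
       (RStore ''y'' (NVar ''l'') (RConst 0))
       (Seq (RStore ''y'' (NVar ''l'') (RConst 1))
         (RSet ''g'' (RAdd (RVar ''g'') (RLoad ''c'' (NVar ''l'')))))"

definition choose_vertices :: com where
  "choose_vertices =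
     Seq (RSet ''g'' (RConst 0)) (For ''l'' (NVar ''n'') (Seq compute_threshold choose_vertex))"

text \<open>The range of \<open>u\<close> is tested because midpoints of arbitrary pairs may leave
  the unit interval, where the thresholds need not guarantee a cover.\<close>

definition good_test :: bexp where
  "good_test =
     BAnd (BNot (RLess (RVar ''u'') (RConst 0)))
       (BAnd (BNot (RLess (RConst 1) (RVar ''u''))) (BNot (RLess (RVar ''w'') (RVar ''g''))))"

definition try_midpoint :: com where
  "try_midpoint =
     Seq (RSet ''u'' (RDiv (RAdd (RLoad ''b'' (NVar ''i'')) (RLoad ''b'' (NVar ''j''))) (RConst 2)))
       (Seq choose_vertices (Cond good_test (RSet ''v'' (RVar ''u'')) Skip))"

definition search_midpoint :: com where
  "search_midpoint = For ''i'' (NVar ''m'') (For ''j'' (NVar ''m'') try_midpoint)"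

text \<open>The search overwrites \<open>y\<close> at each pair, so the selection is computed once
  more at the stored point.\<close>

definition cover_program :: com where
  "cover_program =
     Seq rank_parts (Seq collect_breakpoints
       (Seq search_midpoint (Seq (RSet ''u'' (RVar ''v'')) choose_vertices)))"

lemma runs_rank_parts:
  assumes n: "nmem s ''n'' 0 = n" and p: "nmem s ''p'' = p"
    and zero: "nmem s ''r'' = (\<lambda>_. 0)" "nmem s ''k'' 0 = 0" "nmem s ''h'' 0 = 0" "nmem s ''m'' 0 = 0"
  shows "runs rank_parts s (\<lambda>t s'. t \<le> 5 + n * 6 \<and>
    nmem s' ''k'' 0 = max 2 (card (p ` {..<n})) \<and>
    nmem s' ''h'' 0 = nmem s' ''k'' 0 mod 2 \<and>
    inj_on (nmem s' ''r'') (p ` {..<n}) \<and>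
    nmem s' ''r'' ` p ` {..<n} \<subseteq> {1..nmem s' ''k'' 0} \<and>
    nmem s' ''n'' 0 = n \<and> nmem s' ''m'' 0 = 0 \<and> nmem s' ''p'' = p \<and> rmem s' = rmem s)"
proof -
  \<comment> \<open>The entry 0 of \<open>r\<close> means that a part has no rank yet; this relies
    on memory that is initially zero. The part indices with nonzero entries are exactly those
    already seen.\<close>
  define I where "I i s' \<longleftrightarrow> nmem s' ''i'' 0 = i \<and>
    nmem s' ''k'' 0 = card (p ` {..<i}) \<and>
    nmem s' ''h'' 0 = card (p ` {..<i}) mod 2 \<and>
    (\<forall>q. 0 < nmem s' ''r'' q \<longleftrightarrow> q \<in> p ` {..<i}) \<and>
    inj_on (nmem s' ''r'') (p ` {..<i}) \<and>
    (\<forall>q. nmem s' ''r'' q \<le> card (p ` {..<i})) \<and>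
    nmem s' ''n'' 0 = n \<and> nmem s' ''m'' 0 = 0 \<and> nmem s' ''p'' = p \<and> rmem s' = rmem s"
    for i and s' :: state
  have main: "runs (For ''i'' (NVar ''n'') rank_vertex) s (\<lambda>t s'. t \<le> 2 + n * (4 + 2) \<and> I n s')"
  proof (rule runs_For[where I = I and N = n and T = 4])
    show "I 0 (nstore ''i'' 0 0 s)" using zero n p by (simp add: I_def)
  next
    fix i s' assume i: "i < n" and I: "I i s'"
    have vals: "nmem s' ''i'' 0 = i" "nmem s' ''k'' 0 = card (p ` {..<i})"
      "nmem s' ''h'' 0 = card (p ` {..<i}) mod 2" "nmem s' ''n'' 0 = n" "nmem s' ''m'' 0 = 0"
      "nmem s' ''p'' = p" "rmem s' = rmem s"
      and inj0: "inj_on (nmem s' ''r'') (p ` {..<i})"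
      using I unfolding I_def by - (elim conjE, assumption)+
    have rpos: "0 < nmem s' ''r'' q \<longleftrightarrow> q \<in> p ` {..<i}"
      and le: "nmem s' ''r'' q \<le> card (p ` {..<i})" for q
      using I unfolding I_def by - (elim conjE, metis)+
    have rzero: "nmem s' ''r'' q = 0 \<longleftrightarrow> q \<notin> p ` {..<i}" for q
      using rpos[of q] by linarith
    show "runs rank_vertex s' (\<lambda>t s''. t \<le> 4 \<and> nmem s'' ''i'' 0 = i \<and> I (Suc i) (nstore ''i'' 0 (Suc i) s''))"
    proof (cases "p i \<in> p ` {..<i}")
      case True
      then have im: "p ` {..<Suc i} = p ` {..<i}" by (auto simp: lessThan_Suc)
      show ?thesis unfolding I_def im
        by (simp add: rank_vertex_def True vals rzero rpos inj0 le)
    next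
      case False
      then have im: "p ` {..<Suc i} = insert (p i) (p ` {..<i})" by (auto simp: lessThan_Suc)
      have card: "card (insert (p i) (p ` {..<i})) = Suc (card (p ` {..<i}))"
        using False by simp
      \<comment> \<open>The new rank exceeds all earlier ones, so injectivity survives.\<close>
      have ne: "nmem s' ''r'' q \<noteq> Suc (card (p ` {..<i}))" for q
        using le[of q] by linarith
      have inj: "inj_on ((nmem s' ''r'')(p i := Suc (card (p ` {..<i})))) (insert (p i) (p ` {..<i}))"
        using False inj0 by (auto simp: inj_on_def ne ne[symmetric] split: if_splits)
      have par: "Suc 0 - k mod 2 = Suc k mod 2" for k :: nat by presburger
      show ?thesis unfolding I_def im card using inj
        by (simp add: rank_vertex_def False vals rzero rpos par le le_SucI)
    qed
  qed (auto simp: I_def n)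
  have finish: "runs (Cond (NLess (NVar ''k'') (NConst 2))
           (Seq (NSet ''k'' (NConst 2)) (NSet ''h'' (NConst 0)))
           Skip) s' (\<lambda>u s''. t + u \<le> 5 + n * 6 \<and>
    nmem s'' ''k'' 0 = max 2 (card (p ` {..<n})) \<and>
    nmem s'' ''h'' 0 = nmem s'' ''k'' 0 mod 2 \<and>
    inj_on (nmem s'' ''r'') (p ` {..<n}) \<and>
    nmem s'' ''r'' ` p ` {..<n} \<subseteq> {1..nmem s'' ''k'' 0} \<and>
    nmem s'' ''n'' 0 = n \<and> nmem s'' ''m'' 0 = 0 \<and> nmem s'' ''p'' = p \<and> rmem s'' = rmem s)"
    if t: "t \<le> 2 + n * (4 + 2)" and I: "I n s'" for t s'
  proof -
    have vals: "nmem s' ''k'' 0 = card (p ` {..<n})"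
      "nmem s' ''h'' 0 = card (p ` {..<n}) mod 2" "nmem s' ''n'' 0 = n" "nmem s' ''m'' 0 = 0"
      "nmem s' ''p'' = p" "rmem s' = rmem s" "inj_on (nmem s' ''r'') (p ` {..<n})"
      using I unfolding I_def by - (elim conjE, assumption)+
    have "nmem s' ''r'' q \<in> {1..max 2 (card (p ` {..<n}))}" if "q \<in> p ` {..<n}" for q
    proof -
      have "0 < nmem s' ''r'' q" "nmem s' ''r'' q \<le> card (p ` {..<n})"
        using I that unfolding I_def by - (elim conjE, metis)+
      then show ?thesis by simp
    qed
    then have im: "nmem s' ''r'' ` p ` {..<n} \<subseteq> {1..max 2 (card (p ` {..<n}))}" by blast
    show ?thesis
    proof (cases "card (p ` {..<n}) < 2")
      case True
      then have "max 2 (card (p ` {..<n})) = 2" by simp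
      with im True t show ?thesis by (simp add: vals)
    next
      case False
      then have "max 2 (card (p ` {..<n})) = card (p ` {..<n})" by simp
      with im False t show ?thesis by (simp add: vals)
    qed
  qed
  show ?thesis unfolding rank_parts_def runs_Seq
    by (rule runs_mono[OF main], elim conjE, rule finish)
qed

section \<open>Correctness and running time of the program\<close>

definition append_breakpoint :: "real \<Rightarrow> state \<Rightarrow> state" where
  "append_breakpoint r s = nstore ''m'' 0 (nmem s ''m'' 0 + 1) (rstore ''b'' (nmem s ''m'' 0) r s)"

text \<open>Forgets the order of the array, so that a push becomes an insertion into a set.\<close>

definition collected :: "state \<Rightarrow> real set" where
  "collected s = rmem s ''b'' ` {..<nmem s ''m'' 0}"

lemma append_breakpoint_simps [simp]:
  "nmem (append_breakpoint r s) ''m'' 0 = nmem s ''m'' 0 + 1"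
  "a \<noteq> ''m'' \<Longrightarrow> nmem (append_breakpoint r s) a = nmem s a"
  "a \<noteq> ''b'' \<Longrightarrow> rmem (append_breakpoint r s) a = rmem s a"
  by (auto simp: append_breakpoint_def)

lemma collected_simps [simp]:
  "collected (append_breakpoint r s) = insert r (collected s)"
  "a \<noteq> ''m'' \<Longrightarrow> collected (nstore a i k s) = collected s"
  "a \<noteq> ''b'' \<Longrightarrow> collected (rstore a i x s) = collected s"
  by (auto simp: collected_def append_breakpoint_def lessThan_Suc)

lemma runs_push [simp]: "runs (push e) s Q \<longleftrightarrow> Q 2 (append_breakpoint (rval e s) s)"
  by (simp add: push_def append_breakpoint_def numeral_2_eq_2)

lemma runs_collect_breakpoints:
  assumes n: "nmem s ''n'' 0 = n" and init: "nmem s ''m'' 0 = 0" "rmem s ''w'' 0 = 0"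
    and z: "\<And>v. z v = rmem s ''x'' v * (real (nmem s ''k'' 0) / 2)"
  shows "runs collect_breakpoints s (\<lambda>t s'. t \<le> 8 + n * 16 \<and>
    nmem s' ''m'' 0 = 3 + 6 * n \<and> (\<forall>v<n. rmem s' ''z'' v = z v) \<and>
    rmem s' ''w'' 0 = (\<Sum>v<n. rmem s ''c'' v * z v) \<and>
    {0, 1/2, 1} \<union> (\<Union>v<n. breakpoints (z v)) \<subseteq> collected s' \<and>
    (\<forall>a\<in>{''n'', ''p'', ''r'', ''k'', ''h''}. nmem s' a = nmem s a) \<and> rmem s' ''c'' = rmem s ''c'')"
proof -
  define I where "I i s' \<longleftrightarrow> nmem s' ''i'' 0 = i \<and> nmem s' ''m'' 0 = 3 + 6 * i \<and>
    (\<forall>v<i. rmem s' ''z'' v = z v) \<and>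
    rmem s' ''w'' 0 = (\<Sum>v<i. rmem s ''c'' v * z v) \<and>
    {0, 1/2, 1} \<union> (\<Union>v<i. breakpoints (z v)) \<subseteq> collected s' \<and>
    (\<forall>a\<in>{''n'', ''p'', ''r'', ''k'', ''h''}. nmem s' a = nmem s a) \<and>
    rmem s' ''c'' = rmem s ''c'' \<and> rmem s' ''x'' = rmem s ''x''" for i and s' :: state
  show ?thesis unfolding collect_breakpoints_def runs_Seq runs_push
  proof (rule runs_For[where I = I and N = n and T = 14])
    fix i s' assume i: "i < n" and I: "I i s'"
    have vals: "nmem s' ''i'' 0 = i" "nmem s' ''m'' 0 = 3 + 6 * i"
      "rmem s' ''w'' 0 = (\<Sum>v<i. rmem s ''c'' v * z v)"
      "nmem s' ''n'' = nmem s ''n''" "nmem s' ''p'' = nmem s ''p''" "nmem s' ''r'' = nmem s ''r''"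
      "nmem s' ''k'' = nmem s ''k''" "nmem s' ''h'' = nmem s ''h''"
      "rmem s' ''c'' = rmem s ''c''" "rmem s' ''x'' = rmem s ''x''"
      and zs: "\<forall>v<i. rmem s' ''z'' v = z v"
      and bs: "{0, 1/2, 1} \<union> (\<Union>v<i. breakpoints (z v)) \<subseteq> collected s'"
      using I unfolding I_def by simp_all
    have zi: "rmem s ''x'' i * real (nmem s ''k'' 0) = z i * 2" using z by simp
    have bs': "{0, 1/2, 1} \<union> (\<Union>v<Suc i. breakpoints (z v))
      \<subseteq> insert (1 - z i / 2) (insert ((1 - z i) / 2) (insert (z i + 1/2)
        (insert (z i - 1/2) (insert (1 - z i) (insert (z i) (collected s'))))))"
      using bs by (auto simp: lessThan_Suc breakpoints_def)
    have zs': "\<forall>v<Suc i. ((rmem s' ''z'')(i := z i)) v = z v"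
      using zs by (simp add: less_Suc_eq)
    show "runs collect_vertex s' (\<lambda>t s''. t \<le> 14 \<and> nmem s'' ''i'' 0 = i \<and> I (Suc i) (nstore ''i'' 0 (Suc i) s''))"
      using bs' zs' unfolding I_def by (simp add: collect_vertex_def vals zi)
  qed (auto simp: I_def n init)
qed

lemma runs_compute_threshold:
  assumes "nmem s ''h'' 0 = nmem s ''k'' 0 mod 2"
    and "threshold (nmem s ''k'' 0) (nmem s ''r'' (nmem s ''p'' (nmem s ''l'' 0))) (rmem s ''u'' 0) = r"
  shows "runs compute_threshold s (\<lambda>t s'. t \<le> 4 \<and> s' = rstore ''t'' 0 r s)"
proof -
  have NEq: "bval (NEq e f) s \<longleftrightarrow> nval e s = nval f s" for e f
    by (simp, linarith)
  show ?thesis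
    unfolding compute_threshold_def runs_Cond runs_RStore NEq bval.simps(4)
    using assms by (simp add: threshold_def odd_iff_mod_2_eq_one split del: if_split) (auto simp: not_less)
qed

lemma runs_choose_vertices:
  fixes s :: state
  defines "rk \<equiv> \<lambda>v. nmem s ''r'' (nmem s ''p'' v)"
  defines "ch \<equiv> choose_at (nmem s ''k'' 0) rk (rmem s ''z'') (rmem s ''u'' 0)"
  assumes n: "nmem s ''n'' 0 = n" and h: "nmem s ''h'' 0 = nmem s ''k'' 0 mod 2"
  shows "runs choose_vertices s (\<lambda>t s'. t \<le> 3 + n * 9 \<and> (\<forall>v<n. rmem s' ''y'' v = ch v) \<and>
    rmem s' ''g'' 0 = (\<Sum>v<n. rmem s ''c'' v * ch v) \<and>
    (\<forall>a. a \<noteq> ''l'' \<longrightarrow> nmem s' a = nmem s a) \<and>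
    (\<forall>a. a \<noteq> ''t'' \<and> a \<noteq> ''g'' \<and> a \<noteq> ''y'' \<longrightarrow> rmem s' a = rmem s a))"
proof -
  define I where "I i s' \<longleftrightarrow> nmem s' ''l'' 0 = i \<and> (\<forall>v<i. rmem s' ''y'' v = ch v) \<and>
    rmem s' ''g'' 0 = (\<Sum>v<i. rmem s ''c'' v * ch v) \<and>
    (\<forall>a. a \<noteq> ''l'' \<longrightarrow> nmem s' a = nmem s a) \<and>
    (\<forall>a. a \<noteq> ''t'' \<and> a \<noteq> ''g'' \<and> a \<noteq> ''y'' \<longrightarrow> rmem s' a = rmem s a)" for i and s' :: state
  show ?thesis unfolding choose_vertices_def runs_Seq runs_RStore
  proof (rule runs_For[where I = I and N = n and T = 7])
    fix i s' assume i: "i < n" and I: "I i s'"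
    have l: "nmem s' ''l'' 0 = i" and g: "rmem s' ''g'' 0 = (\<Sum>v<i. rmem s ''c'' v * ch v)"
      and y: "\<And>v. v < i \<Longrightarrow> rmem s' ''y'' v = ch v"
      and fr: "\<And>a. a \<noteq> ''l'' \<Longrightarrow> nmem s' a = nmem s a"
        "\<And>a. a \<noteq> ''t'' \<and> a \<noteq> ''g'' \<and> a \<noteq> ''y'' \<Longrightarrow> rmem s' a = rmem s a"
      using I unfolding I_def by simp_all
    let ?r = "threshold (nmem s ''k'' 0) (rk i) (rmem s ''u'' 0)"
    have "runs compute_threshold s' (\<lambda>t s''. t \<le> 4 \<and> s'' = rstore ''t'' 0 ?r s')"
      using h by (intro runs_compute_threshold) (simp_all add: l fr rk_def)
    then show "runs (Seq compute_threshold
           choose_vertex) s'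
          (\<lambda>t s''. t \<le> 7 \<and> nmem s'' ''l'' 0 = i \<and> I (Suc i) (nstore ''l'' 0 (Suc i) s''))"
      unfolding runs_Seq
    proof (rule runs_mono, elim conjE)
      fix t :: nat and s'' assume t: "t \<le> 4" and s'': "s'' = rstore ''t'' 0 ?r s'"
      have "ch i = (if rmem s ''z'' i < ?r then 0 else 1)"
        by (simp add: ch_def choose_at_def)
      with t show "runs choose_vertex s''
         (\<lambda>u s'''. t + u \<le> 7 \<and> nmem s''' ''l'' 0 = i \<and> I (Suc i) (nstore ''l'' 0 (Suc i) s'''))"
        unfolding s'' I_def by (simp add: choose_vertex_def l fr g y less_Suc_eq)
    qed
  qed (auto simp: I_def n)
qed

text \<open>The invariants claim that \<open>v\<close> is good only if some pair tried so far is
  good, so its initial value does not matter. The hypothesis \<open>ex\<close> discharges this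
  condition once all pairs are tried; a later success merely replaces one good value by
  another.\<close>

lemma runs_search_midpoint:
  fixes s :: state
  defines "rk \<equiv> \<lambda>v. nmem s ''r'' (nmem s ''p'' v)"
  defines "good \<equiv> \<lambda>u. 0 \<le> u \<and> u \<le> 1 \<and>
    (\<Sum>v<nmem s ''n'' 0. rmem s ''c'' v * choose_at (nmem s ''k'' 0) rk (rmem s ''z'') u v) \<le> rmem s ''w'' 0"
  assumes n: "nmem s ''n'' 0 = n" and h: "nmem s ''h'' 0 = nmem s ''k'' 0 mod 2"
    and m: "nmem s ''m'' 0 = m"
    and ex: "\<exists>a\<in>collected s. \<exists>b\<in>collected s. good ((a + b) / 2)"
  shows "runs search_midpoint s (\<lambda>t s'. t \<le> 2 + m * ((2 + m * (8 + 9 * n)) + 2) \<and>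
    good (rmem s' ''v'' 0) \<and>
    (\<forall>a. a \<noteq> ''l'' \<and> a \<noteq> ''i'' \<and> a \<noteq> ''j'' \<longrightarrow> nmem s' a = nmem s a) \<and>
    (\<forall>a. a \<noteq> ''t'' \<and> a \<noteq> ''g'' \<and> a \<noteq> ''y'' \<and> a \<noteq> ''u'' \<and> a \<noteq> ''v'' \<longrightarrow> rmem s' a = rmem s a))"
proof -
  let ?mid = "\<lambda>i j. (rmem s ''b'' i + rmem s ''b'' j) / 2"
  define fr where "fr s' \<longleftrightarrow>
    (\<forall>a. a \<noteq> ''l'' \<and> a \<noteq> ''i'' \<and> a \<noteq> ''j'' \<longrightarrow> nmem s' a = nmem s a) \<and>
    (\<forall>a. a \<noteq> ''t'' \<and> a \<noteq> ''g'' \<and> a \<noteq> ''y'' \<and> a \<noteq> ''u'' \<and> a \<noteq> ''v'' \<longrightarrow> rmem s' a = rmem s a)"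
    for s' :: state
  define I where "I i s' \<longleftrightarrow> nmem s' ''i'' 0 = i \<and> fr s' \<and>
    ((\<exists>a<i. \<exists>b<m. good (?mid a b)) \<longrightarrow> good (rmem s' ''v'' 0))" for i and s' :: state
  define J where "J i j s' \<longleftrightarrow> nmem s' ''i'' 0 = i \<and> nmem s' ''j'' 0 = j \<and> fr s' \<and>
    ((\<exists>a<i. \<exists>b<m. good (?mid a b)) \<or> (\<exists>b<j. good (?mid i b)) \<longrightarrow> good (rmem s' ''v'' 0))"
    for i j and s' :: state
  show ?thesis unfolding search_midpoint_def
  proof (rule runs_For[where I = I and N = m and T = "2 + m * ((6 + n * 9) + 2)"])
    fix i s' assume i: "i < m" and I: "I i s'"
    show "runs (For ''j'' (NVar ''m'') try_midpoint) s' (\<lambda>t s''. t \<le> 2 + m * ((6 + n * 9) + 2) \<and> nmem s'' ''i'' 0 = i \<and>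
             I (Suc i) (nstore ''i'' 0 (Suc i) s''))"
    proof (rule runs_For[where I = "J i" and N = m and T = "6 + n * 9"])
      show "J i 0 (nstore ''j'' 0 0 s')" using I by (simp add: I_def J_def fr_def)
    next
      fix j s'' assume j: "j < m" and J: "J i j s''"
      have ij: "nmem s'' ''i'' 0 = i" "nmem s'' ''j'' 0 = j"
        and frn: "\<And>a. a \<noteq> ''l'' \<and> a \<noteq> ''i'' \<and> a \<noteq> ''j'' \<Longrightarrow> nmem s'' a = nmem s a"
        and frr: "\<And>a. a \<noteq> ''t'' \<and> a \<noteq> ''g'' \<and> a \<noteq> ''y'' \<and> a \<noteq> ''u'' \<and> a \<noteq> ''v'' \<Longrightarrow> rmem s'' a = rmem s a"
        and found: "(\<exists>a<i. \<exists>b<m. good (?mid a b)) \<or> (\<exists>b<j. good (?mid i b)) \<Longrightarrow> good (rmem s'' ''v'' 0)"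
        using J unfolding J_def fr_def by simp_all
      let ?s = "rstore ''u'' 0 (?mid i j) s''"
      have "runs choose_vertices ?s (\<lambda>t s'. t \<le> 3 + n * 9 \<and>
          (\<forall>v<n. rmem s' ''y'' v = choose_at (nmem ?s ''k'' 0) (\<lambda>v. nmem ?s ''r'' (nmem ?s ''p'' v)) (rmem ?s ''z'') (rmem ?s ''u'' 0) v) \<and>
          rmem s' ''g'' 0 = (\<Sum>v<n. rmem ?s ''c'' v * choose_at (nmem ?s ''k'' 0) (\<lambda>v. nmem ?s ''r'' (nmem ?s ''p'' v)) (rmem ?s ''z'') (rmem ?s ''u'' 0) v) \<and>
          (\<forall>a. a \<noteq> ''l'' \<longrightarrow> nmem s' a = nmem ?s a) \<and>
          (\<forall>a. a \<noteq> ''t'' \<and> a \<noteq> ''g'' \<and> a \<noteq> ''y'' \<longrightarrow> rmem s' a = rmem ?s a))"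
        using n h by (intro runs_choose_vertices) (simp_all add: frn)
      then have "runs choose_vertices ?s (\<lambda>t s'''. runs (Cond good_test (RSet ''v'' (RVar ''u'')) Skip) s''' (\<lambda>u s4. 1 + (t + u) \<le> 6 + n * 9 \<and> nmem s4 ''j'' 0 = j \<and> J i (Suc j) (nstore ''j'' 0 (Suc j) s4)))"
      proof (rule runs_mono, elim conjE)
        fix t and s3 :: state
        assume t: "t \<le> 3 + n * 9"
          and g: "rmem s3 ''g'' 0 = (\<Sum>v<n. rmem ?s ''c'' v * choose_at (nmem ?s ''k'' 0) (\<lambda>v. nmem ?s ''r'' (nmem ?s ''p'' v)) (rmem ?s ''z'') (rmem ?s ''u'' 0) v)"
          and fr3n: "\<forall>a. a \<noteq> ''l'' \<longrightarrow> nmem s3 a = nmem ?s a"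
          and fr3r: "\<forall>a. a \<noteq> ''t'' \<and> a \<noteq> ''g'' \<and> a \<noteq> ''y'' \<longrightarrow> rmem s3 a = rmem ?s a"
        have uv: "rmem s3 ''u'' 0 = ?mid i j" "rmem s3 ''v'' = rmem s'' ''v''" "rmem s3 ''w'' = rmem s ''w''"
          "nmem s3 ''i'' 0 = i" "nmem s3 ''j'' 0 = j"
          using fr3n fr3r by (simp_all add: ij frr)
        have fr3: "a \<noteq> ''l'' \<and> a \<noteq> ''i'' \<and> a \<noteq> ''j'' \<Longrightarrow> nmem s3 a = nmem s a"
          "a \<noteq> ''t'' \<and> a \<noteq> ''g'' \<and> a \<noteq> ''y'' \<and> a \<noteq> ''u'' \<and> a \<noteq> ''v'' \<Longrightarrow> rmem s3 a = rmem s a" for a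
          using fr3n fr3r by (simp_all add: frn frr)
        have good: "good (?mid i j) \<longleftrightarrow> 0 \<le> ?mid i j \<and> ?mid i j \<le> 1 \<and> rmem s3 ''g'' 0 \<le> rmem s ''w'' 0"
          unfolding good_def rk_def g n by (simp add: frn frr)
        have cond: "bval good_test s3
           \<longleftrightarrow> good (?mid i j)"
          unfolding good good_test_def by (simp add: uv not_less)
        show "runs (Cond good_test (RSet ''v'' (RVar ''u'')) Skip) s3 (\<lambda>u s4. 1 + (t + u) \<le> 6 + n * 9 \<and> nmem s4 ''j'' 0 = j \<and> J i (Suc j) (nstore ''j'' 0 (Suc j) s4))"
        proof (cases "good (?mid i j)")
          case True
          then show ?thesis unfolding runs_Cond cond using t
            by (simp add: J_def fr_def uv fr3)
        next
          case False
          then have "(\<exists>b<Suc j. good (?mid i b)) \<longleftrightarrow> (\<exists>b<j. good (?mid i b))"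
            by (auto simp: less_Suc_eq)
          with False found show ?thesis unfolding runs_Cond cond J_def using t
            by (simp add: fr_def uv fr3)
        qed
      qed
      then show "runs try_midpoint s'' (\<lambda>t s'''. t \<le> 6 + n * 9 \<and> nmem s''' ''j'' 0 = j \<and> J i (Suc j) (nstore ''j'' 0 (Suc j) s'''))"
        by (simp only: try_midpoint_def runs_Seq runs_RStore rval.simps nval.simps ij frr) (simp add: ij frr)
    next
      fix t s'' assume t: "t \<le> 2 + m * (6 + n * 9 + 2)" and J: "J i m s''"
      have "(\<exists>a<Suc i. \<exists>b<m. good (?mid a b)) \<longleftrightarrow>
          (\<exists>a<i. \<exists>b<m. good (?mid a b)) \<or> (\<exists>b<m. good (?mid i b))"
        by (auto simp: less_Suc_eq)
      then show "t \<le> 2 + m * (6 + n * 9 + 2) \<and> nmem s'' ''i'' 0 = i \<and> I (Suc i) (nstore ''i'' 0 (Suc i) s'')"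
        using t J by (simp add: I_def J_def fr_def)
    qed (auto simp: J_def fr_def m)
  next
    fix t s' assume t: "t \<le> 2 + m * (2 + m * (6 + n * 9 + 2) + 2)" and I: "I m s'"
    have "\<exists>a<m. \<exists>b<m. good (?mid a b)"
      using ex unfolding collected_def m by auto
    with t I show "t \<le> 2 + m * ((2 + m * (8 + 9 * n)) + 2) \<and> good (rmem s' ''v'' 0) \<and>
      (\<forall>a. a \<noteq> ''l'' \<and> a \<noteq> ''i'' \<and> a \<noteq> ''j'' \<longrightarrow> nmem s' a = nmem s a) \<and>
      (\<forall>a. a \<noteq> ''t'' \<and> a \<noteq> ''g'' \<and> a \<noteq> ''y'' \<and> a \<noteq> ''u'' \<and> a \<noteq> ''v'' \<longrightarrow> rmem s' a = rmem s a)"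
      by (simp add: I_def fr_def algebra_simps)
  qed (auto simp: I_def fr_def m)
qed

section \<open>Cubic time bound and the program as a whole\<close>

definition running_time :: "nat \<Rightarrow> nat" where
  "running_time n = (let m = 3 + 6 * n in
     (5 + n * 6) + (8 + n * 16) + (2 + m * ((2 + m * (8 + 9 * n)) + 2)) + 1 + (3 + n * 9))"

lemma running_time_cubic: "(\<lambda>n. real (running_time n)) \<in> O(\<lambda>n. real n ^ 3)"
proof (rule bigoI[of _ 2000])
  have "running_time n \<le> 2000 * n ^ 3" if "n \<ge> 1" for n
  proof -
    \<comment> \<open>The coefficients add up to 1463, and for positive \<open>n\<close> every lower
      power is at most \<open>n ^ 3\<close>.\<close>
    have "running_time n = 324 * n ^ 3 + 612 * n ^ 2 + 424 * n + 103"
      unfolding running_time_def Let_def by algebra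
    moreover have "n ^ 2 \<le> n ^ 3" "n \<le> n ^ 3" "1 \<le> n ^ 3"
      using that power_increasing[of 0 3 n] power_increasing[of 1 3 n] power_increasing[of 2 3 n]
      by simp_all
    ultimately show ?thesis by linarith
  qed
  from of_nat_mono[OF this, where 'a = real]
  have "real (running_time n) \<le> 2000 * real n ^ 3" if "n \<ge> 1" for n
    using that by simp
  then show "\<forall>\<^sub>F n in at_top. norm (real (running_time n)) \<le> 2000 * norm (real n ^ 3)"
    by (intro eventually_at_top_linorderI[of 1]) simp
qed

text \<open>Hyperedges are absent because the program never sees them. The ranking \<open>R\<close>
  and the point \<open>u\<close> are exported so that the cover property can be derived afterwards
  for any \<open>B\<close>.\<close>

lemma runs_cover_program:
  fixes s :: state
  defines "p \<equiv> nmem s ''p''" and "c \<equiv> rmem s ''c''" and "x \<equiv> rmem s ''x''"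
  defines "n \<equiv> nmem s ''n'' 0"
  defines "K \<equiv> max 2 (card (p ` {..<n}))"
  assumes zero: "nmem s ''r'' = (\<lambda>_. 0)" "nmem s ''k'' 0 = 0" "nmem s ''h'' 0 = 0" "nmem s ''m'' 0 = 0"
      "rmem s ''w'' 0 = 0"
    and c: "\<And>v. v < n \<Longrightarrow> 0 \<le> c v" and x: "\<And>v. v < n \<Longrightarrow> 0 \<le> x v"
  shows "runs cover_program s (\<lambda>t s'. t \<le> running_time n \<and>
    (\<exists>R u. inj_on R (p ` {..<n}) \<and> R ` p ` {..<n} \<subseteq> {1..K} \<and> 0 \<le> u \<and> u \<le> 1 \<and>
      (\<forall>v<n. result s' v = choose_at K (\<lambda>v. R (p v)) (\<lambda>v. x v * (real K / 2)) u v) \<and>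
      (\<Sum>v<n. c v * result s' v) \<le> (\<Sum>v<n. c v * (x v * (real K / 2)))))"
    (is "runs _ _ ?Q")
proof -
  define z where "z v = x v * (real K / 2)" for v
  have "runs rank_parts s (\<lambda>t1 s1. runs collect_breakpoints s1 (\<lambda>t2 s2.
    runs search_midpoint s2 (\<lambda>t3 s3. runs choose_vertices (rstore ''u'' 0 (rmem s3 ''v'' 0) s3)
      (\<lambda>t4 s4. ?Q (t1 + (t2 + (t3 + (1 + t4)))) s4))))"
  proof (rule runs_mono[OF runs_rank_parts[of s n p]], goal_cases)
    case (7 t1 s1)
    then have t1: "t1 \<le> 5 + n * 6"
      and s1: "nmem s1 ''k'' 0 = K" "nmem s1 ''h'' 0 = K mod 2" "nmem s1 ''n'' 0 = n"
        "nmem s1 ''m'' 0 = 0" "nmem s1 ''p'' = p" "rmem s1 = rmem s"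
      unfolding K_def by simp_all
    have R: "inj_on (nmem s1 ''r'') (p ` {..<n})" "nmem s1 ''r'' ` p ` {..<n} \<subseteq> {1..K}"
      using 7 unfolding s1(1)[symmetric] by blast+
    define rk where "rk v = nmem s1 ''r'' (p v)" for v
    show ?case
    proof (rule runs_mono[OF runs_collect_breakpoints[of s1 n z]], goal_cases)
      case (5 t2 s2)
      then have t2: "t2 \<le> 8 + n * 16"
        and s2: "nmem s2 ''m'' 0 = 3 + 6 * n" "nmem s2 ''k'' 0 = K" "nmem s2 ''h'' 0 = K mod 2"
          "nmem s2 ''n'' 0 = n" "nmem s2 ''p'' = p" "nmem s2 ''r'' = nmem s1 ''r''"
          "rmem s2 ''c'' = c"
        and z2: "\<And>v. v < n \<Longrightarrow> rmem s2 ''z'' v = z v"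
        and w2: "rmem s2 ''w'' 0 = (\<Sum>v<n. c v * z v)"
        and b2: "{0, 1/2, 1} \<union> (\<Union>v<n. breakpoints (z v)) \<subseteq> collected s2"
        using s1 by (simp_all add: c_def)
      define y where "y u v = choose_at K rk z u v" for u v
      have y: "choose_at (nmem s2 ''k'' 0) (\<lambda>v. nmem s2 ''r'' (nmem s2 ''p'' v)) (rmem s2 ''z'') u v = y u v"
        if "v < n" for u v
        using z2[OF that] by (simp add: y_def choose_at_def rk_def s2)
      define good where "good u \<longleftrightarrow> 0 \<le> u \<and> u \<le> 1 \<and> (\<Sum>v<n. c v * y u v) \<le> (\<Sum>v<n. c v * z v)" for u
      \<comment> \<open>Identifies the test on memory contents with the predicate to which
        \<open>good_midpoint\<close> applies.\<close>
      have good2: "0 \<le> u \<and> u \<le> 1 \<and>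
        (\<Sum>v<nmem s2 ''n'' 0. rmem s2 ''c'' v * choose_at (nmem s2 ''k'' 0) (\<lambda>v. nmem s2 ''r'' (nmem s2 ''p'' v)) (rmem s2 ''z'') u v)
          \<le> rmem s2 ''w'' 0 \<longleftrightarrow> good u" for u
        using y by (simp add: good_def s2(4,7) w2)
      have "\<exists>a\<in>collected s2. \<exists>b\<in>collected s2. good ((a + b) / 2)"
        unfolding good_def y_def
        using c x b2 by (intro good_midpoint) (simp_all add: z_def collected_def)
      then have ex: "\<exists>a\<in>collected s2. \<exists>b\<in>collected s2. 0 \<le> (a + b) / 2 \<and> (a + b) / 2 \<le> 1 \<and>
        (\<Sum>v<nmem s2 ''n'' 0. rmem s2 ''c'' v * choose_at (nmem s2 ''k'' 0) (\<lambda>v. nmem s2 ''r'' (nmem s2 ''p'' v)) (rmem s2 ''z'') ((a + b) / 2) v)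
          \<le> rmem s2 ''w'' 0"
        unfolding good2 .
      show ?case
      proof (rule runs_mono[OF runs_search_midpoint[OF s2(4) _ s2(1) ex]], goal_cases)
        case (2 t3 s3)
        then have t3: "t3 \<le> 2 + (3 + 6 * n) * ((2 + (3 + 6 * n) * (8 + 9 * n)) + 2)"
          and u: "good (rmem s3 ''v'' 0)"
          and fr: "\<And>a. a \<noteq> ''l'' \<and> a \<noteq> ''i'' \<and> a \<noteq> ''j'' \<Longrightarrow> nmem s3 a = nmem s2 a"
            "\<And>a. a \<noteq> ''t'' \<and> a \<noteq> ''g'' \<and> a \<noteq> ''y'' \<and> a \<noteq> ''u'' \<and> a \<noteq> ''v'' \<Longrightarrow> rmem s3 a = rmem s2 a"
          unfolding good2 by blast+
        let ?u = "rmem s3 ''v'' 0" and ?s = "rstore ''u'' 0 (rmem s3 ''v'' 0) s3"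
        show ?case
        proof (rule runs_mono[OF runs_choose_vertices[of ?s n]], goal_cases)
          case (3 t4 s4)
          then have t4: "t4 \<le> 3 + n * 9" and y4: "\<And>v. v < n \<Longrightarrow> result s4 v = y ?u v"
            using y by (simp_all add: fr result_def)
          have "t1 + (t2 + (t3 + (1 + t4))) \<le> running_time n"
            using t1 t2 t3 t4 unfolding running_time_def Let_def by linarith
          moreover have "(\<Sum>v<n. c v * result s4 v) \<le> (\<Sum>v<n. c v * z v)"
            using u y4 by (simp add: good_def)
          moreover have "\<forall>v<n. result s4 v = choose_at K (\<lambda>v. nmem s1 ''r'' (p v)) z ?u v"
            using y4 by (simp add: y_def rk_def[abs_def])
          ultimately show ?case
            using R u unfolding good_def z_def[abs_def] by blast
        qed (simp_all add: fr s2)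
      qed (simp add: s2)
    qed (simp_all add: s1 zero z_def x_def)
  qed (simp_all add: zero n_def p_def)
  then show ?thesis unfolding cover_program_def by simp
qed

section \<open>From the partition to the final theorem\<close>

lemma part_index_in:
  assumes "d_partition V B d Vs" "v \<in> V"
  shows "part_index d Vs v \<in> {1..d}" "v \<in> Vs (part_index d Vs v)"
proof -
  have "\<exists>!i. i \<in> {1..d} \<and> v \<in> Vs i"
    using assms unfolding d_partition_def disjoint_family_on_def by blast
  from theI'[OF this] show "part_index d Vs v \<in> {1..d}" "v \<in> Vs (part_index d Vs v)"
    by (simp_all add: part_index_def)
qed

text \<open>Two vertices of \<open>P\<close> in the same part lie in an intersection of cardinality
  at most 1. Finiteness matters, since \<open>card\<close> is 0 on infinite sets.\<close>

lemma inj_on_part_index: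
  assumes "d_partition V B d Vs" "P \<in> B" "P \<subseteq> V" "finite P"
  shows "inj_on (part_index d Vs) P"
proof (rule inj_onI)
  fix v w assume vw: "v \<in> P" "w \<in> P" "part_index d Vs v = part_index d Vs w"
  let ?A = "P \<inter> Vs (part_index d Vs v)"
  have "card ?A \<le> 1"
    using assms vw part_index_in(1)[OF assms(1), of v] unfolding d_partition_def by blast
  then have "\<forall>a\<in>?A. \<forall>b\<in>?A. a = b"
    using card_le_Suc0_iff_eq[of ?A] assms(4) by simp
  moreover have "v \<in> ?A" "w \<in> ?A"
    using vw assms(3) part_index_in(2)[OF assms(1), of v] part_index_in(2)[OF assms(1), of w] by auto
  ultimately show "v = w" by blast
qed

theorem theorem12:
  "\<exists>(A :: com) (T :: nat \<Rightarrow> nat).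
     (\<lambda>n. real (T n)) \<in> O(\<lambda>n. real n ^ 3) \<and>
     (\<forall>(n :: nat) (d :: nat) (B :: nat set set) (Vs :: nat \<Rightarrow> nat set)
       (c :: nat \<Rightarrow> real) (x :: nat \<Rightarrow> real).
        d \<noteq> 1 \<longrightarrow>
        hypergraph {..<n} B \<longrightarrow>
        d_partition {..<n} B d Vs \<longrightarrow>
        (\<forall>v<n. 0 \<le> c v) \<longrightarrow>
        fractional_vertex_cover {..<n} B x \<longrightarrow>
        (\<exists>t s. exec A (input_state n d Vs c x) t s \<and> t \<le> T n \<and>
           integral_vertex_cover {..<n} B (result s) \<and>
           (\<Sum>v<n. c v * result s v) \<le> real d / 2 * (\<Sum>v<n. c v * x v)))"
proof (rule exI[of _ cover_program], rule exI[of _ running_time],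
    intro conjI running_time_cubic allI impI)
  fix n d :: nat and B :: "nat set set" and Vs :: "nat \<Rightarrow> nat set" and c x :: "nat \<Rightarrow> real"
  assume d: "d \<noteq> 1" and hg: "hypergraph {..<n} B" and part: "d_partition {..<n} B d Vs"
    and c: "\<forall>v<n. 0 \<le> c v" and fvc: "fractional_vertex_cover {..<n} B x"
  let ?s = "input_state n d Vs c x" and ?pi = "part_index d Vs"
  define K where "K = max 2 (card (?pi ` {..<n}))"
  have x: "\<forall>v<n. 0 \<le> x v" using fvc by (simp add: fractional_vertex_cover_def)
  have s: "nmem ?s ''n'' 0 = n" "\<And>v. v < n \<Longrightarrow> nmem ?s ''p'' v = ?pi v"
    "\<And>v. v < n \<Longrightarrow> rmem ?s ''c'' v = c v" "\<And>v. v < n \<Longrightarrow> rmem ?s ''x'' v = x v"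
    by (simp_all add: input_state_def)
  have im: "nmem ?s ''p'' ` {..<n} = ?pi ` {..<n}" using s(2) by (intro image_cong) auto
  obtain t s' R u where run: "exec cover_program ?s t s'" "t \<le> running_time n"
    and R: "inj_on R (?pi ` {..<n})" "R ` ?pi ` {..<n} \<subseteq> {1..K}" and u: "0 \<le> u" "u \<le> 1"
    and res': "\<forall>v<n. result s' v = choose_at K (\<lambda>v. R (nmem ?s ''p'' v)) (\<lambda>v. rmem ?s ''x'' v * (real K / 2)) u v"
    and cost': "(\<Sum>v<n. rmem ?s ''c'' v * result s' v) \<le> (\<Sum>v<n. rmem ?s ''c'' v * (rmem ?s ''x'' v * (real K / 2)))"
    using runs_cover_program[of ?s] c x unfolding s(1) im K_def[symmetric] runs_def
    by (auto simp: s) (auto simp: input_state_def)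
  have res: "result s' v = (if threshold K (R (?pi v)) u \<le> x v * real K / 2 then 1 else 0)" if "v < n" for v
    using res' that by (simp add: choose_at_def s)
  have "integral_vertex_cover {..<n} B (result s')"
    unfolding integral_vertex_cover_def
  proof (intro conjI ballI)
    show "result s' v \<in> {0, 1}" if "v \<in> {..<n}" for v using that by (simp add: res)
  next
    fix P assume P: "P \<in> B"
    then have sub: "P \<subseteq> {..<n}" using hg by (auto simp: hypergraph_def)
    then have fin: "finite P" by (rule finite_subset) simp
    have "inj_on ?pi P" using part P sub fin by (rule inj_on_part_index)
    moreover have "inj_on R (?pi ` P)" using R(1) sub by (elim inj_on_subset) auto
    \<comment> \<open>Distinct vertices of a hyperedge lie in distinct parts, and distinct parts
      have distinct ranks.\<close>
    ultimately have inj: "inj_on (\<lambda>v. R (?pi v)) P" using comp_inj_on[of ?pi P R] by (simp add: comp_def)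
    have "\<exists>v\<in>P. threshold K (R (?pi v)) u \<le> x v * real K / 2"
    proof (rule threshold_covers[OF _ fin inj _ _ u])
      show "(\<lambda>v. R (?pi v)) ` P \<subseteq> {1..K}" using R(2) sub by blast
      show "1 \<le> (\<Sum>v\<in>P. x v)" using fvc P by (simp add: fractional_vertex_cover_def)
    qed (simp add: K_def)
    then obtain v where "v \<in> P" "result s' v = 1" using res sub by auto
    moreover have "0 \<le> result s' w" if "w \<in> P" for w using that sub by (auto simp: res)
    ultimately show "1 \<le> (\<Sum>v\<in>P. result s' v)" using member_le_sum[of v P "result s'"] fin by auto
  qed
  moreover have "(\<Sum>v<n. c v * result s' v) \<le> real d / 2 * (\<Sum>v<n. c v * x v)"
  \<comment> \<open>Without vertices both sums are empty, and \<open>d\<close> may be 0. Otherwise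
    vertex 0 lies in some part, so \<open>d\<close> is positive; as it is not 1, it is at least 2.
    Hence the artificial second part does not push \<open>K\<close> above \<open>d\<close>.\<close>
  proof (cases "n = 0")
    case False
    have "?pi ` {..<n} \<subseteq> {1..d}" using part_index_in(1)[OF part] by auto
    then have "card (?pi ` {..<n}) \<le> d" using card_mono[of "{1..d}"] by force
    moreover have "2 \<le> d" using False d part_index_in(1)[OF part, of 0] by auto
    ultimately have "K \<le> d" by (simp add: K_def)
    have "(\<Sum>v<n. c v * result s' v) \<le> (\<Sum>v<n. c v * (x v * (real K / 2)))"
      using cost' by (simp add: s)
    also have "\<dots> = real K / 2 * (\<Sum>v<n. c v * x v)" by (simp add: sum_distrib_left mult_ac)
    also have "\<dots> \<le> real d / 2 * (\<Sum>v<n. c v * x v)"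
      using \<open>K \<le> d\<close> c x by (intro mult_right_mono sum_nonneg) auto
    finally show ?thesis .
  qed simp
  ultimately show "\<exists>t s. exec cover_program ?s t s \<and> t \<le> running_time n \<and>
      integral_vertex_cover {..<n} B (result s) \<and>
      (\<Sum>v<n. c v * result s v) \<le> real d / 2 * (\<Sum>v<n. c v * x v)"
    using run by blast
qed

end
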